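(* If $G$ is a canceling graph on $n\ge 2$ vertices, then: (a) $G$ is connected; (b) $G$ contains an odd cycle; (c) $G$ has minimum degree at least $2$; and (d) $G$ has at least $n+2$ edges. Moreover, for every $n\ge 5$ there exists an $n$-vertex canceling graph with minimum degree $2$ and exactly $n+2$ edges.
   Context: Graphs are finite and simple. A signing of $G$ is a function $\sigma:E(G)\to\{\pm1\}$. For a path $P$, $\sigma(P)=\sum_{e\in P}\sigma(e)$. The signed distance is $d_\sigma(u,v)=\min_P|\sigma(P)|$ over all $uv$-paths $P$ in $G$ ($\infty$ if none exists, $0$ if $u=v$), and $W_\sigma(G)=\frac12\sum_{u,v\in V(G)}d_\sigma(u,v)$. A graph $G$ is canceling if there exists a signing $\sigma$ with $W_\sigma(G)=0$. *)

theory Defs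
  imports "Graph_Theory.Graph_Theory" "HOL-Library.Extended_Nonnegative_Real"
begin

text \<open>
  A finite simple graph is a \<^locale>\<open>pair_graph\<close>: a finite, symmetric, loop-free set of arcs.
  Every undirected edge is thus represented by two opposite arcs. Signings live on the
  undirected edges, so that opposite arcs get the same sign and edges are counted once.
\<close>

definition uedges :: "'a pair_pre_digraph \<Rightarrow> 'a set set" where
  "uedges G = {{u, v} | u v. (u, v) \<in> parcs G}"

definition signing :: "'a pair_pre_digraph \<Rightarrow> ('a set \<Rightarrow> int) \<Rightarrow> bool" where
  "signing G \<sigma> \<longleftrightarrow> (\<forall>e \<in> uedges G. \<sigma> e \<in> {-1, 1})"

definition path_sign :: "('a set \<Rightarrow> int) \<Rightarrow> ('a \<times> 'a) awalk \<Rightarrow> int" where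
  "path_sign \<sigma> p = (\<Sum>(x, y) \<leftarrow> p. \<sigma> {x, y})"

text \<open>
  In \<^typ>\<open>enat\<close> the infimum of a nonempty set is its minimum and the infimum of the empty set
  is \<open>\<infinity>\<close>. For \<open>u = v\<close> the only path is the empty one, which yields \<open>0\<close>.
\<close>

definition signed_dist :: "'a pair_pre_digraph \<Rightarrow> ('a set \<Rightarrow> int) \<Rightarrow> 'a \<Rightarrow> 'a \<Rightarrow> enat" where
  "signed_dist G \<sigma> u v =
     (INF p \<in> {p. pre_digraph.apath (with_proj G) u p v}. enat (nat \<bar>path_sign \<sigma> p\<bar>))"

definition signed_wiener :: "'a pair_pre_digraph \<Rightarrow> ('a set \<Rightarrow> int) \<Rightarrow> ennreal" where
  "signed_wiener G \<sigma> =
     (1 / 2) * (\<Sum>u \<in> pverts G. \<Sum>v \<in> pverts G. ennreal_of_enat (signed_dist G \<sigma> u v))"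

definition canceling :: "'a pair_pre_digraph \<Rightarrow> bool" where
  "canceling G \<longleftrightarrow> (\<exists>\<sigma>. signing G \<sigma> \<and> signed_wiener G \<sigma> = 0)"

text \<open>In a symmetric arc set the out-degree of a vertex is its number of neighbours.\<close>

definition min_degree :: "'a pair_pre_digraph \<Rightarrow> nat" where
  "min_degree G = Min (out_degree (with_proj G) ` pverts G)"

text \<open>
  The library's cycles include the closed walks \<open>u, v, u\<close> of length 2; in a loop-free graph
  those of odd length have length at least 3 and are the usual odd cycles.
\<close>

definition has_odd_cycle :: "'a pair_pre_digraph \<Rightarrow> bool" where
  "has_odd_cycle G \<longleftrightarrow> (\<exists>p. pre_digraph.cycle (with_proj G) p \<and> odd (length p))"

end

theory Submission
  imports Defs
begin

text \<open>
  For an edge \<open>e = uv\<close>, a \<open>uv\<close>-path of sum zero has even length and avoids \<open>e\<close>, so closing it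
  with \<open>e\<close> gives an odd cycle \<open>C\<close> with \<open>\<sigma>(C) = \<sigma>(e)\<close>. Its first edge shows that \<open>u\<close> has degree at
  least two. For the edge bound, work in the cycle space over the two-element field: a connected
  graph with at most \<open>n + 1\<close> edges has at most four even edge sets, which is incompatible with
  each edge lying in an even set whose sum is the sign of that edge.

  The extremal graphs are subdivisions of \<open>K\<^sub>4\<close> along a single edge, signed alternately on the
  subdivided edge. Two vertices of that path at odd distance are joined around the outside, through
  \<open>0\<close> and \<open>k\<close>; the four paths from \<open>0\<close> to \<open>k\<close> in the rest of the graph have sums
  \<open>0, 1, -1, -2\<close>, which are precisely the values needed.
\<close>

section \<open>Sums, parities and signs on finite set systems\<close>

lemma sum_sym_diff:
  fixes f :: "'b \<Rightarrow> 'c :: comm_semiring_1"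
  assumes "finite A" "finite B"
  shows "sum f (sym_diff A B) + 2 * sum f (A \<inter> B) = sum f A + sum f B"
proof -
  have "sum f (sym_diff A B) = sum f (A - B) + sum f (B - A)"
    using assms by (intro sum.union_disjoint) auto
  moreover have "sum f A = sum f (A \<inter> B) + sum f (A - B)"
    using assms(1) by (rule sum.Int_Diff)
  moreover have "sum f B = sum f (A \<inter> B) + sum f (B - A)"
    using sum.Int_Diff[OF assms(2), of f A] by (simp add: Int_commute)
  ultimately show ?thesis by (simp add: algebra_simps mult_2)
qed

lemma even_card_sym_diff:
  assumes "finite A" "finite B"
  shows "even (card (sym_diff A B)) \<longleftrightarrow> (even (card A) \<longleftrightarrow> even (card B))"
proof -
  have "card (sym_diff A B) + 2 * card (A \<inter> B) = card A + card B"
    using sum_sym_diff[OF assms, of "\<lambda>_. 1::nat"] by simp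
  then show ?thesis by presburger
qed

lemma sum_unit_signs_parity:
  fixes \<sigma> :: "'b \<Rightarrow> int"
  assumes "finite A" "\<forall>e\<in>A. \<sigma> e \<in> {-1, 1}"
  shows "even (sum \<sigma> A) \<longleftrightarrow> even (card A)"
  using assms by (induction A rule: finite_induct) auto

text \<open>Two members of \<open>K\<close> with opposite sums \<open>\<plusminus>1\<close>, together with their symmetric difference,
  would exhaust \<open>K\<close>; the symmetric difference has even sum, so the signs on the two one-sided
  differences are constant, and comparing the two sums gives it exactly two elements.\<close>

lemma sign_cover_card_gt_4:
  fixes K :: "'b set set" and \<sigma> :: "'b \<Rightarrow> int"
  assumes fin: "finite E" and KE: "K \<subseteq> Pow E" and empty: "{} \<in> K"
    and closed: "\<And>A B. A \<in> K \<Longrightarrow> B \<in> K \<Longrightarrow> sym_diff A B \<in> K"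
    and no1: "\<And>A. A \<in> K \<Longrightarrow> card A \<noteq> 1" and no2: "\<And>A. A \<in> K \<Longrightarrow> card A \<noteq> 2"
    and sgn: "\<And>e. e \<in> E \<Longrightarrow> \<sigma> e \<in> {-1, 1}"
    and cover: "\<And>e. e \<in> E \<Longrightarrow> \<exists>C\<in>K. e \<in> C \<and> sum \<sigma> C = \<sigma> e"
    and ne: "E \<noteq> {}"
  shows "4 < card K"
proof (rule ccontr)
  assume "\<not> 4 < card K"
  then have K4: "card K \<le> 4" by simp
  have finK: "finite K" using fin KE by (meson finite_Pow_iff finite_subset)
  have finm: "finite C" if "C \<in> K" for C using that fin KE by (auto intro: finite_subset)
  obtain e0 where e0: "e0 \<in> E" using ne by blast
  define \<alpha> where "\<alpha> = \<sigma> e0"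
  have \<alpha>: "\<alpha> = 1 \<or> \<alpha> = -1" using sgn[OF e0] by (auto simp: \<alpha>_def)
  obtain A where A: "A \<in> K" "e0 \<in> A" "sum \<sigma> A = \<alpha>" using cover[OF e0] by (auto simp: \<alpha>_def)
  \<comment> \<open>If all signs were \<alpha>, the sum over \<open>A\<close> would be \<alpha>
    times its size, forcing a one-element member of \<open>K\<close>. The second set
    \<open>B\<close> is then the one covering an edge of opposite sign.\<close>
  have "\<exists>e\<in>E. \<sigma> e \<noteq> \<alpha>"
  proof (rule ccontr)
    assume "\<not> ?thesis"
    then have "sum \<sigma> A = sum (\<lambda>_. \<alpha>) A" using A(1) KE by (intro sum.cong) auto
    with A(3) \<alpha> have "card A = 1" by auto
    with no1[OF A(1)] show False by simp
  qed
  then obtain e1 where e1: "e1 \<in> E" "\<sigma> e1 = - \<alpha>" using sgn \<alpha> by force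
  obtain B where B: "B \<in> K" "e1 \<in> B" "sum \<sigma> B = - \<alpha>" using cover[OF e1(1)] e1(2) by auto
  define D where "D = sym_diff A B"
  have AB: "A \<noteq> B" using A(3) B(3) \<alpha> by auto
  have DK: "D \<in> K" using closed A(1) B(1) by (simp add: D_def)
  have "card {{}, A, B, D} = 4"
    using A(2) B(2) AB by (auto simp: D_def card_insert_if)
  moreover have "{{}, A, B, D} \<subseteq> K" using empty A B DK by auto
  ultimately have K: "K = {{}, A, B, D}"
    using K4 finK by (metis card_seteq)
  have finAB: "finite A" "finite B" using finm A B by auto
  have evD: "even (sum \<sigma> D)"
    using sum_sym_diff[OF finAB, of \<sigma>] A(3) B(3) unfolding D_def by presburger
  have AmB: "\<sigma> e = \<alpha>" if "e \<in> A - B" for e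
  proof -
    have eE: "e \<in> E" using that A KE by auto
    obtain C where C: "C \<in> K" "e \<in> C" "sum \<sigma> C = \<sigma> e" using cover[OF eE] by blast
    have "C \<noteq> D" using C evD sgn[OF eE] by auto
    with C that K have "C = A" by auto
    with C A show ?thesis by simp
  qed
  have BmA: "\<sigma> e = - \<alpha>" if "e \<in> B - A" for e
  proof -
    have eE: "e \<in> E" using that B KE by auto
    obtain C where C: "C \<in> K" "e \<in> C" "sum \<sigma> C = \<sigma> e" using cover[OF eE] by blast
    have "C \<noteq> D" using C evD sgn[OF eE] by auto
    with C that K have "C = B" by auto
    with C B show ?thesis by simp
  qed
  have "sum \<sigma> A = sum \<sigma> (A \<inter> B) + sum \<sigma> (A - B)"
    using finAB(1) by (rule sum.Int_Diff)
  moreover have "sum \<sigma> B = sum \<sigma> (A \<inter> B) + sum \<sigma> (B - A)"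
    using sum.Int_Diff[OF finAB(2), of \<sigma> A] by (simp add: Int_commute)
  moreover have "sum \<sigma> (A - B) = \<alpha> * int (card (A - B))"
    using AmB by (simp add: mult.commute)
  moreover have "sum \<sigma> (B - A) = - \<alpha> * int (card (B - A))"
    using BmA by (simp add: mult.commute)
  ultimately have "\<alpha> * (int (card (A - B)) + int (card (B - A))) = \<alpha> * 2"
    using A(3) B(3) by (simp add: distrib_left)
  then have "card (A - B) + card (B - A) = 2"
    using \<alpha> by auto
  moreover have "card D = card (A - B) + card (B - A)"
    unfolding D_def using finAB by (intro card_Un_disjoint) auto
  ultimately show False using no2[OF DK] by simp
qed

section \<open>Boundaries and the cycle space modulo two\<close>

text \<open>This is the boundary map of the graph over the two-element field;
  \<open>cycle_space\<close> below is its kernel.\<close>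

definition odd_verts :: "'a set set \<Rightarrow> 'a set" where
  "odd_verts F = {v. odd (card {e \<in> F. v \<in> e})}"

lemma odd_verts_empty [simp]: "odd_verts {} = {}"
  by (simp add: odd_verts_def)

lemma odd_verts_singleton: "odd_verts {e} = e"
proof -
  have "{f \<in> {e}. v \<in> f} = (if v \<in> e then {e} else {})" for v by auto
  then show ?thesis by (auto simp: odd_verts_def)
qed

text \<open>Linearity of the boundary: symmetric difference is addition modulo two, and it commutes
  with restricting to the edges at a vertex.\<close>

lemma odd_verts_sym_diff:
  assumes "finite A" "finite B"
  shows "odd_verts (sym_diff A B) = sym_diff (odd_verts A) (odd_verts B)"
proof -
  have "{e \<in> sym_diff A B. v \<in> e} = sym_diff {e \<in> A. v \<in> e} {e \<in> B. v \<in> e}" for v by auto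
  then have "even (card {e \<in> sym_diff A B. v \<in> e}) \<longleftrightarrow>
      (even (card {e \<in> A. v \<in> e}) \<longleftrightarrow> even (card {e \<in> B. v \<in> e}))" for v
    using even_card_sym_diff[of "{e \<in> A. v \<in> e}" "{e \<in> B. v \<in> e}"] assms by simp
  then show ?thesis by (auto simp: odd_verts_def)
qed

definition cycle_space :: "'a pair_pre_digraph \<Rightarrow> 'a set set set" where
  "cycle_space G = {F. F \<subseteq> uedges G \<and> odd_verts F = {}}"

definition walk_edges :: "('a \<times> 'a) awalk \<Rightarrow> 'a set set" where
  "walk_edges p = (\<lambda>(x, y). {x, y}) ` set p"

lemma path_sign_Nil [simp]: "path_sign \<sigma> [] = 0"
  and path_sign_Cons [simp]: "path_sign \<sigma> ((x, y) # p) = \<sigma> {x, y} + path_sign \<sigma> p"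
  and path_sign_append [simp]: "path_sign \<sigma> (p @ q) = path_sign \<sigma> p + path_sign \<sigma> q"
  by (simp_all add: path_sign_def)

lemma path_sign_rev_path [simp]: "path_sign \<sigma> (rev_path p) = path_sign \<sigma> p"
  by (induction p) (auto simp: insert_commute)

section \<open>Zero-sum paths and their edge sets\<close>

context pair_graph
begin

lemma uedges_iff: "{u, v} \<in> uedges G \<longleftrightarrow> (u, v) \<in> parcs G"
  by (auto simp: uedges_def doubleton_eq_iff dest: arcs_symmetric)

lemma finite_uedges: "finite (uedges G)"
proof -
  have "uedges G = (\<lambda>(u, v). {u, v}) ` parcs G" by (auto simp: uedges_def)
  then show ?thesis using pair_finite_arcs by simp
qed

lemma uedgesE:
  assumes "e \<in> uedges G"
  obtains u v where "e = {u, v}" "(u, v) \<in> parcs G" "u \<noteq> v"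
  using assms no_loops' by (auto simp: uedges_def)

text \<open>A sum of nonnegative terms vanishes only termwise, and an infimum in \<open>enat\<close>
  over a nonempty set is attained. From here on only zero-sum paths matter.\<close>

lemma canceling_iff:
  "canceling G \<longleftrightarrow> (\<exists>\<sigma>. signing G \<sigma> \<and>
     (\<forall>u\<in>pverts G. \<forall>v\<in>pverts G. \<exists>p. apath u p v \<and> path_sign \<sigma> p = 0))"
proof -
  have dist: "signed_dist G \<sigma> u v = 0 \<longleftrightarrow> (\<exists>p. apath u p v \<and> path_sign \<sigma> p = 0)" for \<sigma> u v
  proof
    assume "signed_dist G \<sigma> u v = 0"
    moreover define S where "S = (\<lambda>p. enat (nat \<bar>path_sign \<sigma> p\<bar>)) ` {p. apath u p v}"
    ultimately have Inf0: "Inf S = 0" by (simp add: signed_dist_def)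
    \<comment> \<open>The infimum of the empty set is \<infinity>, so the value 0 guarantees a
      path.\<close>
    then have "S \<noteq> {}" by (auto simp: Inf_enat_def)
    then have "Inf S \<in> S" by (auto simp: Inf_enat_def intro: LeastI)
    then have "0 \<in> S" by (simp only: Inf0)
    then obtain p where "apath u p v" "0 = enat (nat \<bar>path_sign \<sigma> p\<bar>)"
      unfolding S_def by blast
    then show "\<exists>p. apath u p v \<and> path_sign \<sigma> p = 0"
      by (auto simp: enat_0_iff)
  next
    assume "\<exists>p. apath u p v \<and> path_sign \<sigma> p = 0"
    then obtain p where "apath u p v" "path_sign \<sigma> p = 0" by blast
    then have "signed_dist G \<sigma> u v \<le> enat (nat \<bar>path_sign \<sigma> p\<bar>)"
      unfolding signed_dist_def by (intro INF_lower) auto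
    with \<open>path_sign \<sigma> p = 0\<close> show "signed_dist G \<sigma> u v = 0" by (simp flip: zero_enat_def)
  qed
  have half: "(1 / 2 :: ennreal) \<noteq> 0"
    by (simp add: ennreal_divide_eq_0_iff)
  have enn0: "ennreal_of_enat x = 0 \<longleftrightarrow> x = 0" for x
    using ennreal_of_enat_inj[of x 0] by simp
  have "signed_wiener G \<sigma> = 0 \<longleftrightarrow>
      (\<forall>u\<in>pverts G. \<forall>v\<in>pverts G. signed_dist G \<sigma> u v = 0)" for \<sigma>
    using half pair_finite_verts
    by (simp add: signed_wiener_def sum_eq_0_iff enn0)
  then show ?thesis by (simp add: canceling_def dist)
qed

lemma connected_if_apaths:
  assumes "pverts G \<noteq> {}" "\<And>u v. u \<in> pverts G \<Longrightarrow> v \<in> pverts G \<Longrightarrow> \<exists>p. apath u p v"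
  shows "Digraph_Component.connected (with_proj G)"
  using assms reachable_mk_symmetricI
  by (auto simp: connected_def strongly_connected_def reachable_apath)

text \<open>A path repeats no vertex, hence no edge, so passing from the arc list to the edge set
  loses neither sum nor length. The boundary is written as a symmetric difference so that it is
  empty when \<open>u = v\<close>. All facts share one induction, because the freshness of the first
  edge rests on the second.\<close>

lemma apath_edges:
  assumes "apath u p v"
  shows "walk_edges p \<subseteq> uedges G" "\<Union>(walk_edges p) \<subseteq> set (pawalk_verts u p)"
    and "path_sign \<sigma> p = sum \<sigma> (walk_edges p)"
    and "length p = card (walk_edges p)"
    and "odd_verts (walk_edges p) = sym_diff {u} {v}"
proof -
  have "walk_edges p \<subseteq> uedges G \<and> \<Union>(walk_edges p) \<subseteq> set (pawalk_verts u p)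
    \<and> path_sign \<sigma> p = sum \<sigma> (walk_edges p) \<and> length p = card (walk_edges p)
    \<and> odd_verts (walk_edges p) = sym_diff {u} {v}"
    using assms
  proof (induction p arbitrary: u)
    case Nil
    then show ?case by (simp add: walk_edges_def apath_Nil_iff)
  next
    case (Cons a p)
    obtain b where a: "a = (u, b)" "(u, b) \<in> parcs G" "apath b p v" "u \<notin> set (pawalk_verts b p)"
      using Cons.prems by (cases a) (auto simp: apath_Cons_iff)
    note IH = Cons.IH[OF a(3)]
    have fin: "finite (walk_edges p)" by (simp add: walk_edges_def)
    \<comment> \<open>Edges of the tail join vertices visited by the tail, and \<open>u\<close> is
      not among these.\<close>
    have new: "{u, b} \<notin> walk_edges p" using IH a(4) by auto
    have ins: "walk_edges (a # p) = insert {u, b} (walk_edges p)" by (simp add: walk_edges_def a)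
    have "walk_edges (a # p) = sym_diff {{u, b}} (walk_edges p)" using ins new by auto
    then have "odd_verts (walk_edges (a # p)) = sym_diff {u, b} (sym_diff {b} {v})"
      using odd_verts_sym_diff[of "{{u, b}}" "walk_edges p"] fin IH by (simp add: odd_verts_singleton)
    moreover have "u \<noteq> b" using a(2) no_loops' by blast
    ultimately have "odd_verts (walk_edges (a # p)) = sym_diff {u} {v}" by auto
    moreover have "b \<in> set (pawalk_verts b p)" by (cases p) (use a(3) in \<open>auto simp: apath_Cons_iff\<close>)
    moreover have "{u, b} \<in> uedges G" using a(2) by (simp add: uedges_iff)
    moreover have "path_sign \<sigma> (a # p) = sum \<sigma> (walk_edges (a # p))"
      unfolding ins using IH new fin by (simp add: a(1))
    moreover have "length (a # p) = card (walk_edges (a # p))"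
      using IH new fin by (simp add: ins)
    moreover have "\<Union>(walk_edges (a # p)) \<subseteq> set (pawalk_verts u (a # p))"
      unfolding ins using IH \<open>b \<in> set (pawalk_verts b p)\<close> by (auto simp: a(1))
    ultimately show ?case using IH by (simp only: ins) simp
  qed
  then show "walk_edges p \<subseteq> uedges G" "\<Union>(walk_edges p) \<subseteq> set (pawalk_verts u p)"
    and "path_sign \<sigma> p = sum \<sigma> (walk_edges p)"
    and "length p = card (walk_edges p)"
    and "odd_verts (walk_edges p) = sym_diff {u} {v}" by auto
qed

text \<open>A path can use the edge joining its ends only by consisting of that edge alone, and then
  its sum is 1 or -1.\<close>

lemma apath_not_closing_edge:
  assumes "apath u p v" "signing G \<sigma>" "path_sign \<sigma> p = 0"
  shows "{u, v} \<notin> walk_edges p"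
proof (cases p)
  case Nil
  then show ?thesis by (simp add: walk_edges_def)
next
  case (Cons a q)
  obtain b where a: "a = (u, b)" "(u, b) \<in> parcs G" "apath b q v" "u \<notin> set (pawalk_verts b q)"
    using assms(1) Cons by (cases a) (auto simp: apath_Cons_iff)
  have "{u, v} \<notin> walk_edges q" using apath_edges(2)[OF a(3)] a(4) by auto
  moreover have "b \<noteq> v"
  proof
    assume "b = v"
    then have "q = []" using a(3) apath_nonempty_ends by blast
    then show False using assms(2,3) Cons a uedges_iff[of u b] by (auto simp: signing_def)
  qed
  ultimately show ?thesis by (auto simp: walk_edges_def Cons a doubleton_eq_iff)
qed

section \<open>Size of the cycle space\<close>

lemma cycle_space_closed:
  assumes "A \<in> cycle_space G" "B \<in> cycle_space G"
  shows "sym_diff A B \<in> cycle_space G"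
proof -
  have "finite A" "finite B"
    using assms finite_uedges by (auto simp: cycle_space_def intro: finite_subset)
  then show ?thesis using assms by (auto simp: cycle_space_def odd_verts_sym_diff)
qed

lemma cycle_space_card_ne_1:
  assumes "A \<in> cycle_space G"
  shows "card A \<noteq> 1"
proof
  assume "card A = 1"
  then obtain e where "A = {e}" by (auto simp: card_1_singleton_iff)
  with assms show False
    by (auto simp: cycle_space_def odd_verts_singleton elim: uedgesE)
qed

text \<open>Simplicity of the graph enters here: edges are vertex sets, so distinct edges have
  distinct boundaries.\<close>

lemma cycle_space_card_ne_2:
  assumes "A \<in> cycle_space G"
  shows "card A \<noteq> 2"
proof
  assume "card A = 2"
  then obtain e f where ef: "A = {e, f}" "e \<noteq> f" by (auto simp: card_2_iff)
  then have "A = sym_diff {e} {f}" by auto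
  then have "odd_verts A = sym_diff e f"
    using odd_verts_sym_diff[of "{e}" "{f}"] by (simp add: odd_verts_singleton)
  then show False using assms ef(2) by (auto simp: cycle_space_def)
qed

text \<open>With n vertices and m edges, the cycle space of a connected graph has dimension at most
  m - n + 1; the product form avoids subtraction in the exponent. Every subset of the vertices other
  than \<open>r\<close> is a boundary away from \<open>r\<close>, so the cycle space has at least
  2^(n-1) cosets.\<close>

lemma card_cycle_space_le:
  assumes r: "r \<in> pverts G" and reach: "\<And>v. v \<in> pverts G \<Longrightarrow> \<exists>p. apath r p v"
  shows "card (cycle_space G) * 2 ^ (card (pverts G) - 1) \<le> 2 ^ card (uedges G)"
proof -
  let ?V = "pverts G - {r}"
  have fin: "finite F" if "F \<subseteq> uedges G" for F using that finite_uedges finite_subset by blast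
  \<comment> \<open>Adding a path from \<open>r\<close> to \<open>v\<close> toggles exactly
    \<open>v\<close> and \<open>r\<close>, and \<open>r\<close> is disregarded.\<close>
  have ex: "\<exists>F\<subseteq>uedges G. odd_verts F - {r} = S" if "S \<subseteq> ?V" for S
  proof -
    have "finite S" using that pair_finite_verts finite_subset by blast
    then show ?thesis using that
    proof (induction S rule: finite_induct)
      case empty
      show ?case by (rule exI[of _ "{}"]) simp
    next
      case (insert v S)
      obtain F where F: "F \<subseteq> uedges G" "odd_verts F - {r} = S" using insert by auto
      obtain p where p: "apath r p v" using reach insert by blast
      note e = apath_edges[OF p]
      show ?case
      proof (intro exI conjI)
        show "sym_diff F (walk_edges p) \<subseteq> uedges G" using F e(1) by auto
        have "odd_verts (sym_diff F (walk_edges p)) = sym_diff (odd_verts F) (sym_diff {r} {v})"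
          using odd_verts_sym_diff[OF fin[OF F(1)] fin[OF e(1)]] e(5) by simp
        moreover have "v \<notin> S" "v \<noteq> r" using insert by auto
        ultimately show "odd_verts (sym_diff F (walk_edges p)) - {r} = insert v S"
          using F(2) by auto
      qed
    qed
  qed
  define f where "f S = (SOME F. F \<subseteq> uedges G \<and> odd_verts F - {r} = S)" for S
  have f: "f S \<subseteq> uedges G" "odd_verts (f S) - {r} = S" if "S \<subseteq> ?V" for S
    using someI_ex[OF ex[OF that]] unfolding f_def by auto
  \<comment> \<open>The boundary away from \<open>r\<close> recovers \<open>S\<close>, and
    cancelling the representative \<open>f S\<close> then recovers \<open>C\<close>; hence the map
    is injective.\<close>
  let ?h = "\<lambda>(S, C). sym_diff (f S) C"
  have bd: "odd_verts (sym_diff (f S) C) - {r} = S" if "S \<subseteq> ?V" "C \<in> cycle_space G" for S C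
  proof -
    have C: "C \<subseteq> uedges G" "odd_verts C = {}" using that by (auto simp: cycle_space_def)
    have "odd_verts (sym_diff (f S) C) = odd_verts (f S)"
      using odd_verts_sym_diff[OF fin[OF f(1)[OF that(1)]] fin[OF C(1)]] C(2) by simp
    then have "odd_verts (sym_diff (f S) C) - {r} = odd_verts (f S) - {r}" by (simp only:)
    also have "\<dots> = S" by (rule f(2)[OF that(1)])
    finally show ?thesis .
  qed
  have "inj_on ?h (Pow ?V \<times> cycle_space G)"
  proof (rule inj_onI)
    fix x y assume xy: "x \<in> Pow ?V \<times> cycle_space G" "y \<in> Pow ?V \<times> cycle_space G" "?h x = ?h y"
    obtain S C where x: "x = (S, C)" by (cases x)
    obtain T D where y: "y = (T, D)" by (cases y)
    have "S = odd_verts (sym_diff (f S) C) - {r}" using bd[of S C] xy(1) x by auto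
    also have "\<dots> = odd_verts (sym_diff (f T) D) - {r}" using xy(3) by (simp add: x y)
    also have "\<dots> = T" using bd[of T D] xy(2) y by auto
    finally have "S = T" .
    then have "sym_diff (f S) C = sym_diff (f S) D" using xy(3) by (simp add: x y)
    then have "C = D" by blast
    with \<open>S = T\<close> show "x = y" by (simp add: x y)
  qed
  moreover have "?h ` (Pow ?V \<times> cycle_space G) \<subseteq> Pow (uedges G)"
  proof (rule image_subsetI)
    fix x assume x: "x \<in> Pow ?V \<times> cycle_space G"
    obtain S C where "x = (S, C)" by (cases x)
    with x f(1)[of S] show "?h x \<in> Pow (uedges G)" by (auto simp: cycle_space_def)
  qed
  ultimately have "card (Pow ?V \<times> cycle_space G) \<le> card (Pow (uedges G))"
    using finite_uedges by (intro card_inj_on_le) auto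
  then show ?thesis
    using r pair_finite_verts finite_uedges by (simp add: card_cartesian_product card_Pow mult.commute)
qed

section \<open>The necessary conditions\<close>

lemma ex_neighbour:
  assumes "card (pverts G) \<ge> 2" "u \<in> pverts G" "\<And>v. v \<in> pverts G \<Longrightarrow> \<exists>p. apath u p v"
  obtains v where "(u, v) \<in> parcs G"
proof -
  have "\<not> pverts G \<subseteq> {u}" using assms(1) card_mono[of "{u}" "pverts G"] by auto
  then obtain w where w: "w \<in> pverts G" "w \<noteq> u" by blast
  then obtain p where "apath u p w" using assms(3) by blast
  with w that show thesis by (cases p) (auto simp: apath_Nil_iff apath_Cons_iff)
qed

lemma canceling_necessary:
  assumes n2: "card (pverts G) \<ge> 2" and canc: "canceling G"
  shows "Digraph_Component.connected (with_proj G)" "has_odd_cycle G"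
    "min_degree G \<ge> 2" "card (uedges G) \<ge> card (pverts G) + 2"
proof -
  obtain \<sigma> where \<sigma>: "signing G \<sigma>"
    and zero: "\<And>u v. u \<in> pverts G \<Longrightarrow> v \<in> pverts G \<Longrightarrow> \<exists>p. apath u p v \<and> path_sign \<sigma> p = 0"
    using canc by (auto simp: canceling_iff)
  have sgn: "\<sigma> e \<in> {-1, 1}" if "e \<in> uedges G" for e using \<sigma> that by (auto simp: signing_def)
  have reach: "\<exists>p. apath u p v" if "u \<in> pverts G" "v \<in> pverts G" for u v using zero that by blast
  have "pverts G \<noteq> {}" using n2 by auto
  then obtain r where r: "r \<in> pverts G" by blast
  show "Digraph_Component.connected (with_proj G)"
    using \<open>pverts G \<noteq> {}\<close> reach by (rule connected_if_apaths)
  obtain s where rs: "(r, s) \<in> parcs G" using ex_neighbour[OF n2 r] reach r by blast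
  show "has_odd_cycle G"
  proof -
    have "s \<in> pverts G" using rs in_arcsD2 by blast
    then obtain p where p: "apath s p r" "path_sign \<sigma> p = 0" using zero r by blast
    note e = apath_edges[OF p(1)]
    have "even (length p)"
      using sum_unit_signs_parity[of "walk_edges p" \<sigma>] sgn e(1,4) e(3)[of \<sigma>] p(2)
        finite_subset[OF e(1) finite_uedges] by auto
    \<comment> \<open>\<open>cycle\<close> asks for distinctness only in the tail of the vertex
      list, which here is the vertex list of the path \<open>p\<close>.\<close>
    moreover have "cycle ((r, s) # p)"
      using p(1) rs r by (auto simp: cycle_def apath_def awalk_Cons_iff)
    ultimately show ?thesis unfolding has_odd_cycle_def by (intro exI[of _ "(r, s) # p"]) auto
  qed
  have "out_degree (with_proj G) u \<ge> 2" if u: "u \<in> pverts G" for u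
  proof -
    obtain v where v: "(u, v) \<in> parcs G" using ex_neighbour[OF n2 u] reach u by blast
    then have "u \<noteq> v" using no_loops' by blast
    moreover have "v \<in> pverts G" using v in_arcsD2 by blast
    ultimately obtain p where p: "apath u p v" "path_sign \<sigma> p = 0"
      using zero[OF u, of v] by blast
    with \<open>u \<noteq> v\<close> obtain w q where q: "p = (u, w) # q" "(u, w) \<in> parcs G"
      by (cases p) (auto simp: apath_Nil_iff apath_Cons_iff)
    have "w \<noteq> v" using apath_not_closing_edge[OF p(1) \<sigma> p(2)] by (auto simp: q walk_edges_def)
    then have "card {(u, v), (u, w)} = 2" by auto
    moreover have "{(u, v), (u, w)} \<subseteq> out_arcs (with_proj G) u" using v q by auto
    moreover have "finite (out_arcs (with_proj G) u)" using pair_finite_arcs by (auto simp: out_arcs_def)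
    ultimately show ?thesis unfolding out_degree_def by (metis card_mono)
  qed
  then show "min_degree G \<ge> 2"
    using \<open>pverts G \<noteq> {}\<close> pair_finite_verts by (simp add: min_degree_def)
  have "4 < card (cycle_space G)"
  proof (rule sign_cover_card_gt_4[where E = "uedges G" and \<sigma> = \<sigma>])
    show "\<exists>C\<in>cycle_space G. e \<in> C \<and> sum \<sigma> C = \<sigma> e" if e: "e \<in> uedges G" for e
    proof -
      obtain u v where uv: "e = {u, v}" "(u, v) \<in> parcs G" "u \<noteq> v" using e by (rule uedgesE)
      obtain p where p: "apath u p v" "path_sign \<sigma> p = 0"
        using zero in_arcsD1[OF uv(2)] in_arcsD2[OF uv(2)] by blast
      note w = apath_edges[OF p(1)]
      have fin: "finite (walk_edges p)" by (simp add: walk_edges_def)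
      have new: "e \<notin> walk_edges p" using apath_not_closing_edge[OF p(1) \<sigma> p(2)] uv(1) by simp
      \<comment> \<open>Since \<open>e\<close> is fresh, inserting it is a symmetric difference, and
        its boundary cancels that of the path.\<close>
      then have "insert e (walk_edges p) = sym_diff {e} (walk_edges p)" by auto
      then have "odd_verts (insert e (walk_edges p)) = {}"
        using odd_verts_sym_diff[of "{e}" "walk_edges p"] fin uv w(5) by (auto simp: odd_verts_singleton)
      then have "insert e (walk_edges p) \<in> cycle_space G" using e w(1) by (auto simp: cycle_space_def)
      moreover have "sum \<sigma> (insert e (walk_edges p)) = \<sigma> e" using fin new w(3)[of \<sigma>] p(2) by simp
      ultimately show ?thesis by blast
    qed
    show "uedges G \<noteq> {}" using rs by (auto simp: uedges_def)
    show "cycle_space G \<subseteq> Pow (uedges G)" "{} \<in> cycle_space G" by (auto simp: cycle_space_def)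
  qed (fact finite_uedges sgn cycle_space_closed cycle_space_card_ne_1 cycle_space_card_ne_2)+
  moreover have "card (cycle_space G) * 2 ^ (card (pverts G) - 1) \<le> 2 ^ card (uedges G)"
    using card_cycle_space_le[OF r reach[OF r]] by simp
  \<comment> \<open>With n vertices and m edges this reads 2^(n+1) < 2^m; its strictness yields n +
    2 rather than n + 1.\<close>
  ultimately have "4 * 2 ^ (card (pverts G) - 1) < (2::nat) ^ card (uedges G)"
    by (meson less_le_trans mult_less_mono1 zero_less_numeral zero_less_power)
  moreover have "4 * 2 ^ (card (pverts G) - 1) = (2::nat) ^ (card (pverts G) + 1)"
    using n2 by (cases "card (pverts G)") auto
  ultimately have "(2::nat) ^ (card (pverts G) + 1) < 2 ^ card (uedges G)" by simp
  then have "card (pverts G) + 1 < card (uedges G)" by (rule power_less_imp_less_exp[rotated]) simp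
  then show "card (uedges G) \<ge> card (pverts G) + 2" by simp
qed

section \<open>A calculus of signed paths\<close>

text \<open>The exact vertex set \<open>X\<close> is recorded so that two paths can be joined after
  comparing vertex sets, without handling arc lists.\<close>

definition signed_path :: "('a set \<Rightarrow> int) \<Rightarrow> 'a \<Rightarrow> 'a set \<Rightarrow> 'a \<Rightarrow> int \<Rightarrow> bool" where
  "signed_path \<sigma> u X v s \<longleftrightarrow>
     (\<exists>p. apath u p v \<and> set (pawalk_verts u p) = X \<and> path_sign \<sigma> p = s)"

lemma signed_path_refl: "u \<in> pverts G \<Longrightarrow> signed_path \<sigma> u {u} u 0"
  unfolding signed_path_def by (rule exI[of _ "[]"]) (simp add: apath_Nil_iff)

lemma signed_path_edge:
  assumes "(u, v) \<in> parcs G"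
  shows "signed_path \<sigma> u {u, v} v (\<sigma> {u, v})"
proof -
  have "u \<noteq> v" "v \<in> pverts G" using assms no_loops' in_arcsD2 by blast+
  then show ?thesis unfolding signed_path_def
    using assms by (intro exI[of _ "[(u, v)]"]) (simp add: apath_Nil_iff apath_Cons_iff)
qed

lemma signed_path_rev:
  assumes "signed_path \<sigma> u X v s"
  shows "signed_path \<sigma> v X u s"
proof -
  obtain p where p: "apath u p v" "set (pawalk_verts u p) = X" "path_sign \<sigma> p = s"
    using assms by (auto simp: signed_path_def)
  then have "awalk u p v" by (auto simp: apath_def)
  then have "awalk v (rev_path p) u" "pawalk_verts v (rev_path p) = rev (pawalk_verts u p)"
    using awalk_rev_path' awalk_verts_rev_path by auto
  with p show ?thesis unfolding signed_path_def
    by (intro exI[of _ "rev_path p"]) (auto simp: apath_def)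
qed

lemma signed_path_append:
  assumes "signed_path \<sigma> u X w a" "signed_path \<sigma> w Y v b" "X \<inter> Y \<subseteq> {w}"
  shows "signed_path \<sigma> u (X \<union> Y) v (a + b)"
proof -
  obtain p where p: "apath u p w" "set (pawalk_verts u p) = X" "path_sign \<sigma> p = a"
    using assms(1) by (auto simp: signed_path_def)
  obtain q where q: "apath w q v" "set (pawalk_verts w q) = Y" "path_sign \<sigma> q = b"
    using assms(2) by (auto simp: signed_path_def)
  have aw: "awalk u p w" "awalk w q v" using p q by (auto simp: apath_def)
  then have pq: "awalk u (p @ q) v" by simp
  have verts: "pawalk_verts u (p @ q) = pawalk_verts u p @ tl (pawalk_verts w q)"
    using awalk_verts_append[OF pq] aw by auto
  have hd: "pawalk_verts w q = w # tl (pawalk_verts w q)"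
    using aw(2) by (cases q) (auto simp: awalk_Cons_iff)
  have "distinct (w # tl (pawalk_verts w q))" using q(1) hd by (metis apath_def)
  moreover have "Y = insert w (set (tl (pawalk_verts w q)))" using q(2) hd by (metis list.simps(15))
  moreover have "w \<in> X" using p(2) aw(1) by auto
  ultimately have "distinct (pawalk_verts u (p @ q))" "set (pawalk_verts u (p @ q)) = X \<union> Y"
    using p assms(3) by (auto simp: verts apath_def)
  then show ?thesis unfolding signed_path_def
    using pq p(3) q(3) by (intro exI[of _ "p @ q"]) (simp add: apath_def)
qed

lemma cancelingI:
  assumes "signing G \<sigma>"
    and "\<And>u v. u \<in> pverts G \<Longrightarrow> v \<in> pverts G \<Longrightarrow> \<exists>X. signed_path \<sigma> u X v 0"
  shows "canceling G"
  unfolding canceling_iff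
proof (intro exI[of _ \<sigma>] conjI ballI)
  show "signing G \<sigma>" by (rule assms(1))
  show "\<exists>p. apath u p v \<and> path_sign \<sigma> p = 0" if "u \<in> pverts G" "v \<in> pverts G" for u v
    using assms(2)[OF that] by (auto simp: signed_path_def)
qed

end

section \<open>The extremal graphs\<close>

text \<open>A subdivision of \<open>K\<^sub>4\<close>: the alternately signed path \<open>0, \<dots>, k\<close> takes the place of one
  edge, and \<open>k + 1\<close>, \<open>k + 2\<close> are the other two branch vertices.\<close>

definition K4_subdivision :: "nat \<Rightarrow> nat pair_pre_digraph" where
  "K4_subdivision k = \<lparr>pverts = {..k + 2}, parcs = {(u, v).
     {u, v} \<in> (\<lambda>i. {i, Suc i}) ` {..<k + 2} \<union> {{0, k + 1}, {0, k + 2}, {k, k + 2}}}\<rparr>"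

text \<open>In \<open>K4_subdivision\<close>, the indices \<open>i = k\<close> and
  \<open>i = k + 1\<close> contribute the edges from \<open>k + 1\<close> to \<open>k\<close> and to
  \<open>k + 2\<close>. The signs of the five edges off the subdivided one are chosen for the four
  path sums listed in \<open>bridge\<close> below. The default -1 also covers non-edges, so being a
  signing is immediate.\<close>

definition K4_sign :: "nat \<Rightarrow> nat set \<Rightarrow> int" where
  "K4_sign k e =
     (if e \<in> {{i, Suc i} | i. i < k \<and> even i} \<union> {{k + 1, k + 2}, {k, k + 2}} then 1 else -1)"

text \<open>For \<open>k = 0\<close> the edges \<open>{0, k + 2}\<close> and
  \<open>{k, k + 2}\<close> would coincide, with conflicting signs.\<close>

lemma K4_sign_simps:
  assumes "k \<ge> 1"
  shows "i < k \<Longrightarrow> K4_sign k {i, Suc i} = (if even i then 1 else -1)"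
    "K4_sign k {0, k + 1} = -1" "K4_sign k {0, k + 2} = -1" "K4_sign k {k + 1, k} = -1"
    "K4_sign k {k + 2, k} = 1" "K4_sign k {k + 1, k + 2} = 1"
  using assms by (auto simp: K4_sign_def doubleton_eq_iff)

lemma uedges_of_edge_set:
  assumes "\<And>e. e \<in> E \<Longrightarrow> \<exists>u v. e = {u, v}"
  shows "uedges \<lparr>pverts = V, parcs = {(u, v). {u, v} \<in> E}\<rparr> = E"
proof
  show "uedges \<lparr>pverts = V, parcs = {(u, v). {u, v} \<in> E}\<rparr> \<subseteq> E"
    by (auto simp: uedges_def)
  show "E \<subseteq> uedges \<lparr>pverts = V, parcs = {(u, v). {u, v} \<in> E}\<rparr>"
  proof
    fix e assume e: "e \<in> E"
    then obtain u v where "e = {u, v}" using assms by blast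
    with e show "e \<in> uedges \<lparr>pverts = V, parcs = {(u, v). {u, v} \<in> E}\<rparr>"
      unfolding uedges_def by simp blast
  qed
qed

lemma uedges_K4_subdivision:
  "uedges (K4_subdivision k) =
     (\<lambda>i. {i, Suc i}) ` {..<k + 2} \<union> {{0, k + 1}, {0, k + 2}, {k, k + 2}}"
  unfolding K4_subdivision_def by (rule uedges_of_edge_set) (elim UnE imageE insertE; blast)

lemma pverts_K4_subdivision [simp]: "pverts (K4_subdivision k) = {..k + 2}"
  by (simp add: K4_subdivision_def)

lemma pair_graph_K4_subdivision: "pair_graph (K4_subdivision k)"
proof -
  have sub: "parcs (K4_subdivision k) \<subseteq> {..k + 2} \<times> {..k + 2}"
    by (auto simp: K4_subdivision_def doubleton_eq_iff)
  have sym: "sym (parcs (K4_subdivision k))"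
    unfolding K4_subdivision_def by (rule symI) (simp add: insert_commute)
  have loopfree: "fst e \<noteq> snd e" if "e \<in> parcs (K4_subdivision k)" for e
    using that by (auto simp: K4_subdivision_def doubleton_eq_iff)
  show ?thesis
  proof unfold_locales
    show "fst e \<in> pverts (K4_subdivision k)" "snd e \<in> pverts (K4_subdivision k)"
      if "e \<in> parcs (K4_subdivision k)" for e
      using that sub by (cases e; auto)+
    show "finite (parcs (K4_subdivision k))" using sub by (rule finite_subset) simp
    show "symmetric (with_proj (K4_subdivision k))" using sym by (simp add: symmetric_def)
  qed (simp, fact loopfree)
qed

lemma canceling_K4_subdivision:
  assumes k: "k \<ge> 1"
  shows "canceling (K4_subdivision k)"
proof -
  interpret pair_graph "K4_subdivision k" by (rule pair_graph_K4_subdivision)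
  let ?P = "signed_path (K4_sign k)"
  note sign = K4_sign_simps[OF k]
  have edge: "?P u {u, v} v s"
    if "K4_sign k {u, v} = s" "{u, v} \<in> uedges (K4_subdivision k)" for u v s
    using that signed_path_edge by (auto simp: uedges_iff)
  have xp: "?P 0 {0, k + 1} (k + 1) (-1)" and xq: "?P 0 {0, k + 2} (k + 2) (-1)"
    and py: "?P (k + 1) {k + 1, k} k (-1)" and qy: "?P (k + 2) {k + 2, k} k 1"
    and pq: "?P (k + 1) {k + 1, k + 2} (k + 2) 1"
    using edge[OF sign(2)] edge[OF sign(3)] edge[OF sign(4)] edge[OF sign(5)] edge[OF sign(6)]
    by (auto simp: uedges_K4_subdivision insert_commute)
  have qp: "?P (k + 2) {k + 1, k + 2} (k + 1) 1" using pq by (rule signed_path_rev)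
  \<comment> \<open>An alternating sum is 0 over an even number of terms and otherwise equals its
    first term, the sign of the edge leaving \<open>i\<close>.\<close>
  have thread: "?P i {i..j} j (if even i = even j then 0 else if even i then 1 else -1)"
    if "i \<le> j" "j \<le> k" for i j
    using that
  proof (induction j rule: dec_induct)
    case base
    then show ?case using signed_path_refl[of i] by simp
  next
    case (step j)
    have "?P j {j, Suc j} (Suc j) (if even j then 1 else -1)"
      using edge[OF sign(1)[of j]] step.prems by (auto simp: uedges_K4_subdivision)
    from signed_path_append[OF step.IH this] step
    have "?P i ({i..j} \<union> {j, Suc j}) (Suc j)
        ((if even i = even j then 0 else if even i then 1 else -1) + (if even j then 1 else -1))"
      by auto
    moreover have "{i..j} \<union> {j, Suc j} = {i..Suc j}" using step.hyps by auto
    ultimately show ?case by (auto split: if_splits)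
  qed
  have to0: "?P i {0..i} 0 (if even i then 0 else 1)" if "i \<le> k" for i
    using signed_path_rev[OF thread[of 0 i]] that by (auto split: if_splits)
  have via: "?P i ({0..i} \<union> Y) v ((if even i then 0 else 1) + b)"
    if "i \<le> k" "?P 0 Y v b" "{0..i} \<inter> Y \<subseteq> {0}" for i Y v b
    using signed_path_append[OF to0] that by blast
  have x_q_p: "?P 0 ({0, k + 2} \<union> {k + 1, k + 2}) (k + 1) 0"
    using signed_path_append[OF xq qp] k by auto
  have x_p_q: "?P 0 ({0, k + 1} \<union> {k + 1, k + 2}) (k + 2) 0"
    using signed_path_append[OF xp pq] k by auto
  \<comment> \<open>The walk back to 0 has sum 0 or 1. In the first case the detour through
    \<open>k + 2\<close> of sum 0 follows, in the second the direct edge of sign -1;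
    \<open>to_q\<close> is symmetric.\<close>
  have to_p: "\<exists>X. ?P i X (k + 1) 0" if "i \<le> k" for i
    using via[OF that x_q_p] via[OF that xp] that by (cases "even i") auto
  have to_q: "\<exists>X. ?P i X (k + 2) 0" if "i \<le> k" for i
    using via[OF that x_p_q] via[OF that xq] that by (cases "even i") auto
  have p_q: "\<exists>X. ?P (k + 1) X (k + 2) 0"
    using signed_path_append[OF py signed_path_rev[OF qy]] by auto
  \<comment> \<open>Confining \<open>X\<close> to the branch vertices keeps the bridge off the
    interior of the subdivided edge, so it can be joined to pieces of that edge at both
    ends.\<close>
  have bridge: "\<exists>X \<subseteq> {0, k, k + 1, k + 2}. ?P 0 X k b" if b: "b \<in> {0, 1, -1, -2}" for b
  proof -
    have ex: "\<exists>X \<subseteq> {0, k, k + 1, k + 2}. ?P 0 X k c"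
      if "?P 0 X k c" "X \<subseteq> {0, k, k + 1, k + 2}" for X c
      using that by blast
    have "?P 0 ({0, k + 2} \<union> {k + 2, k}) k 0"
      using signed_path_append[OF xq qy] k by auto
    note zero = ex[OF this]
    have "?P 0 ({0, k + 1} \<union> {k + 1, k}) k (-2)"
      using signed_path_append[OF xp py] k by auto
    note minus_two = ex[OF this]
    have "?P 0 ({0, k + 1} \<union> {k + 1, k + 2} \<union> {k + 2, k}) k 1"
      using signed_path_append[OF x_p_q qy] k by auto
    note one = ex[OF this]
    have "?P 0 ({0, k + 2} \<union> {k + 1, k + 2} \<union> {k + 1, k}) k (-1)"
      using signed_path_append[OF x_q_p py] k by auto
    note minus_one = ex[OF this]
    consider "b = 0" | "b = 1" | "b = -1" | "b = -2" using b by blast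
    then show ?thesis
    proof cases
      case 1
      show ?thesis unfolding 1 by (rule zero) blast
    next
      case 2
      show ?thesis unfolding 2 by (rule one) blast
    next
      case 3
      show ?thesis unfolding 3 by (rule minus_one) blast
    next
      case 4
      show ?thesis unfolding 4 by (rule minus_two) blast
    qed
  qed
  have around: "\<exists>X. ?P i X j 0" if ij: "i < j" "j \<le> k" "even i \<noteq> even j" for i j
  proof -
    define a :: int where "a = (if even i then 0 else 1)"
    define c :: int where "c = (if even j = even k then 0 else if even j then 1 else -1)"
    \<comment> \<open>The outer pieces contribute \<open>a\<close> and \<open>c\<close>, and the
      bridge must compensate. For even \<open>i\<close> the required value is 0 or 1, for odd
      \<open>i\<close> it is -2 or -1, according as \<open>k\<close> is odd or even.\<close>
    have "- a - c \<in> {0, 1, -1, -2}" using ij(3) by (auto simp: a_def c_def)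
    then obtain X where X: "X \<subseteq> {0, k, k + 1, k + 2}" "?P 0 X k (- a - c)" using bridge by blast
    have "{0..i} \<inter> X \<subseteq> {0}" "i \<le> k" using X(1) ij by auto
    then have "?P i ({0..i} \<union> X) k (a + (- a - c))"
      using via[OF _ X(2), of i] unfolding a_def[symmetric] by blast
    moreover have "?P k {j..k} j c"
      using signed_path_rev[OF thread[of j k]] ij by (simp add: c_def)
    moreover have "({0..i} \<union> X) \<inter> {j..k} \<subseteq> {k}" using X(1) ij by auto
    ultimately have "?P i ({0..i} \<union> X \<union> {j..k}) j (a + (- a - c) + c)"
      by (rule signed_path_append)
    then show ?thesis by auto
  qed
  have zero: "\<exists>X. ?P u X v 0" if "u \<le> v" "v \<le> k + 2" for u v
  proof -
    note uv = that
    consider "u = v" | "u < v" "v \<le> k" | "u \<le> k" "v = k + 1" | "u \<le> k" "v = k + 2"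
      | "u = k + 1" "v = k + 2"
      using uv by linarith
    then show ?thesis
    proof cases
      case 1
      then show ?thesis using signed_path_refl[of u] uv by auto
    next
      case 2
      then show ?thesis using around[of u v] thread[of u v] by (cases "even u = even v") auto
    qed (use to_p to_q p_q in auto)
  qed
  show ?thesis
  proof (rule cancelingI)
    show "signing (K4_subdivision k) (K4_sign k)" by (simp add: signing_def K4_sign_def)
    show "\<exists>X. ?P u X v 0" if uv: "u \<in> pverts (K4_subdivision k)" "v \<in> pverts (K4_subdivision k)" for u v
    proof (cases "u \<le> v")
      case True
      then show ?thesis using uv zero[of u v] by simp
    next
      case False
      then obtain X where "?P v X u 0" using uv zero[of v u] by auto
      then show ?thesis using signed_path_rev by blast
    qed
  qed
qed

text \<open>An upper bound suffices: the graph has \<open>k + 3\<close> vertices and is canceling,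
  so \<open>canceling_necessary\<close> supplies the matching lower bound.\<close>

lemma card_uedges_K4_subdivision_le: "card (uedges (K4_subdivision k)) \<le> k + 5"
proof -
  have "card (uedges (K4_subdivision k)) \<le> card ((\<lambda>i::nat. {i, Suc i}) ` {..<k + 2})
      + card {{0, k + 1}, {0, k + 2}, {k, k + 2}}"
    unfolding uedges_K4_subdivision by (rule card_Un_le)
  also have "\<dots> \<le> (k + 2) + 3"
    using card_image_le[of "{..<k + 2}" "\<lambda>i::nat. {i, Suc i}"]
    by (intro add_mono) (auto simp: card_insert_if)
  finally show ?thesis by simp
qed

text \<open>For \<open>k \<ge> 2\<close> the vertex 1 is interior to the subdivided edge. This is
  the source of the condition \<open>n \<ge> 5\<close>, as \<open>n = k + 3\<close>.\<close>

lemma min_degree_K4_subdivision_le: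
  assumes "k \<ge> 2"
  shows "min_degree (K4_subdivision k) \<le> 2"
proof -
  have "out_arcs (with_proj (K4_subdivision k)) 1 \<subseteq> {(1, 0), (1, 2)}"
    using assms by (auto simp: K4_subdivision_def out_arcs_def doubleton_eq_iff)
  then have "out_degree (with_proj (K4_subdivision k)) 1 \<le> card {(1::nat, 0::nat), (1, 2)}"
    unfolding out_degree_def by (rule card_mono[rotated]) simp
  then have "out_degree (with_proj (K4_subdivision k)) 1 \<le> 2" by simp
  moreover have "min_degree (K4_subdivision k) \<le> out_degree (with_proj (K4_subdivision k)) 1"
    unfolding min_degree_def by (rule Min_le) auto
  ultimately show ?thesis by linarith
qed

theorem theorem1p5:
  shows "(\<forall>(G :: 'a pair_pre_digraph) n.
            pair_graph G \<and> card (pverts G) = n \<and> n \<ge> 2 \<and> canceling G \<longrightarrow>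
              Digraph_Component.connected (with_proj G)
            \<and> has_odd_cycle G
            \<and> min_degree G \<ge> 2
            \<and> card (uedges G) \<ge> n + 2)
       \<and> (\<forall>n \<ge> 5. \<exists>H :: nat pair_pre_digraph.
            pair_graph H \<and> card (pverts H) = n \<and> canceling H
            \<and> min_degree H = 2 \<and> card (uedges H) = n + 2)"
proof (intro conjI allI impI)
  fix n :: nat assume "n \<ge> 5"
  then obtain k where k: "n = k + 3" "k \<ge> 2" by (intro that[of "n - 3"]) auto
  let ?H = "K4_subdivision k"
  have card: "card (pverts ?H) = n" by (simp add: k)
  have canc: "canceling ?H" using canceling_K4_subdivision k by simp
  note nec = pair_graph.canceling_necessary[OF pair_graph_K4_subdivision _ canc]
  have "min_degree ?H = 2"
    using nec(3) min_degree_K4_subdivision_le[OF k(2)] card k by simp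
  moreover have "card (uedges ?H) = n + 2"
    using nec(4) card_uedges_K4_subdivision_le[of k] card k by simp
  ultimately show "\<exists>H :: nat pair_pre_digraph. pair_graph H \<and> card (pverts H) = n \<and> canceling H
      \<and> min_degree H = 2 \<and> card (uedges H) = n + 2"
    using pair_graph_K4_subdivision card canc by blast
qed (use pair_graph.canceling_necessary in metis)+

end
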